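(* Let $R$ be a commutative ring with unity, let $S\subseteq R$ be a multiplicatively closed subset, and let $\phi:R\to S^{-1}R$ be the map $\phi(r)=\frac{r}{1}$. If $R$ is an $S$-field, then $S^{-1}R$ is a $\phi(S)$-field.
   Context: A multiplicatively closed subset $S$ of a commutative ring $R$ is a subset with $1\in S$, $0\notin S$, and $st\in S$ for all $s,t\in S$. Here $\phi(S)=\left\{\frac{s}{1}\mid s\in S\right\}$, a multiplicatively closed subset of $S^{-1}R$. For a commutative ring $A$ with multiplicatively closed subset $T$: an ideal $I$ of $A$ with $I\cap T=\emptyset$ is $T$-maximal if there exists $t\in T$ such that for every ideal $J$ of $A$ with $I\subseteq J$, either $tJ\subseteq I$ or $J\cap T\neq\emptyset$; and $A$ is a $T$-field if its zero ideal is a $T$-maximal ideal of $A$. *)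

theory Defs
  imports "HOL-Algebra.Ideal"
begin

locale mult_closed_subset = cring A + submonoid T A for T and A (structure) +
  assumes zero_notin: "\<zero> \<notin> T"

locale T_maximal_ideal = mult_closed_subset T A + ideal I A for I and T and A (structure) +
  assumes disjoint: "I \<inter> T = {}"
    and T_maximal: "\<exists>t\<in>T. \<forall>J. ideal J A \<longrightarrow> I \<subseteq> J \<longrightarrow> t <# J \<subseteq> I \<or> J \<inter> T \<noteq> {}"

locale T_field = mult_closed_subset T A for T and A (structure) +
  assumes zero_T_maximal: "T_maximal_ideal {\<zero>} T A"

subsection \<open>Localization\<close>

text \<open>The extra factor \<open>u\<close> is needed because \<open>S\<close> may contain zero divisors.\<close>

definition frac_rel :: "'a set \<Rightarrow> ('a, 'b) ring_scheme \<Rightarrow> (('a \<times> 'a) \<times> ('a \<times> 'a)) set"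
  where "frac_rel S R =
    {((r, s), (r', s')). r \<in> carrier R \<and> s \<in> S \<and> r' \<in> carrier R \<and> s' \<in> S \<and>
      (\<exists>u\<in>S. u \<otimes>\<^bsub>R\<^esub> (s' \<otimes>\<^bsub>R\<^esub> r \<ominus>\<^bsub>R\<^esub> s \<otimes>\<^bsub>R\<^esub> r') = \<zero>\<^bsub>R\<^esub>)}"

definition frac :: "'a set \<Rightarrow> ('a, 'b) ring_scheme \<Rightarrow> 'a \<Rightarrow> 'a \<Rightarrow> ('a \<times> 'a) set"
  where "frac S R r s = frac_rel S R `` {(r, s)}"

text \<open>
  The operations are unions over all representatives; each union is a single class because the
  operations respect the relation (\<open>frac_mult\<close> and \<open>frac_add\<close> below).
\<close>

definition localization :: "'a set \<Rightarrow> ('a, 'b) ring_scheme \<Rightarrow> ('a \<times> 'a) set ring"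
  where "localization S R =
    \<lparr>carrier = (carrier R \<times> S) // frac_rel S R,
     mult = (\<lambda>C D. \<Union>p\<in>C. \<Union>q\<in>D. case (p, q) of ((r, s), (r', s')) \<Rightarrow>
       frac S R (r \<otimes>\<^bsub>R\<^esub> r') (s \<otimes>\<^bsub>R\<^esub> s')),
     one = frac S R \<one>\<^bsub>R\<^esub> \<one>\<^bsub>R\<^esub>,
     zero = frac S R \<zero>\<^bsub>R\<^esub> \<one>\<^bsub>R\<^esub>,
     add = (\<lambda>C D. \<Union>p\<in>C. \<Union>q\<in>D. case (p, q) of ((r, s), (r', s')) \<Rightarrow>
       frac S R (s' \<otimes>\<^bsub>R\<^esub> r \<oplus>\<^bsub>R\<^esub> s \<otimes>\<^bsub>R\<^esub> r') (s \<otimes>\<^bsub>R\<^esub> s'))\<rparr>"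

definition localization_map :: "'a set \<Rightarrow> ('a, 'b) ring_scheme \<Rightarrow> 'a \<Rightarrow> ('a \<times> 'a) set"
  where "localization_map S R r = frac S R r \<one>\<^bsub>R\<^esub>"

context mult_closed_subset
begin

lemma frac_relI:
  assumes "r \<in> carrier A" "s \<in> T" "r' \<in> carrier A" "s' \<in> T" "u \<in> T"
    and "u \<otimes> (s' \<otimes> r) = u \<otimes> (s \<otimes> r')"
  shows "((r, s), (r', s')) \<in> frac_rel T A"
proof -
  have "u \<otimes> (s' \<otimes> r \<ominus> s \<otimes> r') = u \<otimes> (s' \<otimes> r) \<ominus> u \<otimes> (s \<otimes> r')"
    using assms(1-5) by (simp add: r_distr r_minus minus_eq)
  also have "\<dots> = \<zero>" using assms by (simp add: minus_eq r_neg)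
  finally show ?thesis using assms by (auto simp: frac_rel_def)
qed

lemma frac_relE:
  assumes "((r, s), (r', s')) \<in> frac_rel T A"
  obtains u where "r \<in> carrier A" "s \<in> T" "r' \<in> carrier A" "s' \<in> T" "u \<in> T"
    "u \<otimes> (s' \<otimes> r) = u \<otimes> (s \<otimes> r')"
proof -
  from assms obtain u where u: "r \<in> carrier A" "s \<in> T" "r' \<in> carrier A" "s' \<in> T" "u \<in> T"
    "u \<otimes> (s' \<otimes> r \<ominus> s \<otimes> r') = \<zero>" by (auto simp: frac_rel_def)
  have "u \<otimes> (s' \<otimes> r) \<ominus> u \<otimes> (s \<otimes> r') = \<zero>"
    using u by (simp add: r_distr r_minus minus_eq)
  then have "\<ominus> (\<ominus> (u \<otimes> (s \<otimes> r'))) = u \<otimes> (s' \<otimes> r)"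
    using u(1-5) by (intro minus_equality) (simp_all add: minus_eq)
  then have "u \<otimes> (s' \<otimes> r) = u \<otimes> (s \<otimes> r')"
    using u(1-5) by simp
  with u that show thesis by blast
qed

lemma equiv_frac_rel: "equiv (carrier A \<times> T) (frac_rel T A)"
proof (rule equivI)
  show "frac_rel T A \<subseteq> (carrier A \<times> T) \<times> (carrier A \<times> T)"
    by (auto simp: frac_rel_def)
  show "refl_on (carrier A \<times> T) (frac_rel T A)"
    by (rule refl_onI) (auto intro: frac_relI[where u = \<one>])
  show "sym (frac_rel T A)"
  proof (rule symI, clarify)
    fix r s r' s' assume "((r, s), (r', s')) \<in> frac_rel T A"
    then obtain u where "r \<in> carrier A" "s \<in> T" "r' \<in> carrier A" "s' \<in> T" "u \<in> T"
        "u \<otimes> (s' \<otimes> r) = u \<otimes> (s \<otimes> r')"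
      by (rule frac_relE)
    then show "((r', s'), (r, s)) \<in> frac_rel T A"
      by (intro frac_relI[where u = u]) auto
  qed
  show "trans (frac_rel T A)"
  proof (rule transI, clarify)
    fix a s b t c v
    assume 1: "((a, s), (b, t)) \<in> frac_rel T A" and 2: "((b, t), (c, v)) \<in> frac_rel T A"
    from 1 obtain x where x: "a \<in> carrier A" "s \<in> T" "b \<in> carrier A" "t \<in> T" "x \<in> T"
        "x \<otimes> (t \<otimes> a) = x \<otimes> (s \<otimes> b)"
      by (rule frac_relE)
    from 2 obtain y where y: "b \<in> carrier A" "t \<in> T" "c \<in> carrier A" "v \<in> T" "y \<in> T"
        "y \<otimes> (v \<otimes> b) = y \<otimes> (t \<otimes> c)"
      by (rule frac_relE)
    have "(x \<otimes> y \<otimes> t) \<otimes> (v \<otimes> a) = (y \<otimes> v) \<otimes> (x \<otimes> (t \<otimes> a))"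
      using x(1-5) y(1-5) by (simp add: m_ac)
    also have "\<dots> = (x \<otimes> s) \<otimes> (y \<otimes> (v \<otimes> b))"
      unfolding x(6) using x(1-5) y(1-5) by (simp add: m_ac)
    also have "\<dots> = (x \<otimes> y \<otimes> t) \<otimes> (s \<otimes> c)"
      unfolding y(6) using x(1-5) y(1-5) by (simp add: m_ac)
    finally show "((a, s), (c, v)) \<in> frac_rel T A"
      using x(1-5) y(1-5) by (intro frac_relI[where u = "x \<otimes> y \<otimes> t"]) auto
  qed
qed

lemma frac_mult:
  assumes "r \<in> carrier A" "s \<in> T" "r' \<in> carrier A" "s' \<in> T"
  shows "frac T A r s \<otimes>\<^bsub>localization T A\<^esub> frac T A r' s' = frac T A (r \<otimes> r') (s \<otimes> s')"
proof -
  have "congruent2 (frac_rel T A) (frac_rel T A)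
          (\<lambda>(r, s) (r', s'). frac T A (r \<otimes> r') (s \<otimes> s'))"
  proof (rule congruent2I'; clarify)
    fix a s b t c v d w
    assume 1: "((a, s), (b, t)) \<in> frac_rel T A" and 2: "((c, v), (d, w)) \<in> frac_rel T A"
    from 1 obtain x where x: "a \<in> carrier A" "s \<in> T" "b \<in> carrier A" "t \<in> T" "x \<in> T"
        "x \<otimes> (t \<otimes> a) = x \<otimes> (s \<otimes> b)"
      by (rule frac_relE)
    from 2 obtain y where y: "c \<in> carrier A" "v \<in> T" "d \<in> carrier A" "w \<in> T" "y \<in> T"
        "y \<otimes> (w \<otimes> c) = y \<otimes> (v \<otimes> d)"
      by (rule frac_relE)
    have "(x \<otimes> y) \<otimes> ((t \<otimes> w) \<otimes> (a \<otimes> c)) = (x \<otimes> (t \<otimes> a)) \<otimes> (y \<otimes> (w \<otimes> c))"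
      using x(1-5) y(1-5) by (simp add: m_ac)
    also have "\<dots> = (x \<otimes> y) \<otimes> ((s \<otimes> v) \<otimes> (b \<otimes> d))"
      unfolding x(6) y(6) using x(1-5) y(1-5) by (simp add: m_ac)
    finally have "((a \<otimes> c, s \<otimes> v), (b \<otimes> d, t \<otimes> w)) \<in> frac_rel T A"
      using x(1-5) y(1-5) by (intro frac_relI[where u = "x \<otimes> y"]) auto
    then show "frac T A (a \<otimes> c) (s \<otimes> v) = frac T A (b \<otimes> d) (t \<otimes> w)"
      unfolding frac_def by (rule equiv_class_eq[OF equiv_frac_rel])
  qed
  from UN_equiv_class2[OF equiv_frac_rel equiv_frac_rel this, of "(r, s)" "(r', s')"] assms
  show ?thesis by (simp add: localization_def frac_def case_prod_unfold)
qed

lemma frac_add: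
  assumes "r \<in> carrier A" "s \<in> T" "r' \<in> carrier A" "s' \<in> T"
  shows "frac T A r s \<oplus>\<^bsub>localization T A\<^esub> frac T A r' s' =
    frac T A (s' \<otimes> r \<oplus> s \<otimes> r') (s \<otimes> s')"
proof -
  have "congruent2 (frac_rel T A) (frac_rel T A)
          (\<lambda>(r, s) (r', s'). frac T A (s' \<otimes> r \<oplus> s \<otimes> r') (s \<otimes> s'))"
  proof (rule congruent2I'; clarify)
    fix a s b t c v d w
    assume 1: "((a, s), (b, t)) \<in> frac_rel T A" and 2: "((c, v), (d, w)) \<in> frac_rel T A"
    from 1 obtain x where x: "a \<in> carrier A" "s \<in> T" "b \<in> carrier A" "t \<in> T" "x \<in> T"
        "x \<otimes> (t \<otimes> a) = x \<otimes> (s \<otimes> b)"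
      by (rule frac_relE)
    from 2 obtain y where y: "c \<in> carrier A" "v \<in> T" "d \<in> carrier A" "w \<in> T" "y \<in> T"
        "y \<otimes> (w \<otimes> c) = y \<otimes> (v \<otimes> d)"
      by (rule frac_relE)
    have "(x \<otimes> y) \<otimes> ((t \<otimes> w) \<otimes> (v \<otimes> a \<oplus> s \<otimes> c)) =
        (y \<otimes> v \<otimes> w) \<otimes> (x \<otimes> (t \<otimes> a)) \<oplus> (x \<otimes> s \<otimes> t) \<otimes> (y \<otimes> (w \<otimes> c))"
      using x(1-5) y(1-5) by (simp add: r_distr m_ac)
    also have "\<dots> = (x \<otimes> y) \<otimes> ((s \<otimes> v) \<otimes> (w \<otimes> b \<oplus> t \<otimes> d))"
      unfolding x(6) y(6) using x(1-5) y(1-5) by (simp add: r_distr m_ac)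
    finally have "((v \<otimes> a \<oplus> s \<otimes> c, s \<otimes> v), (w \<otimes> b \<oplus> t \<otimes> d, t \<otimes> w)) \<in> frac_rel T A"
      using x(1-5) y(1-5) by (intro frac_relI[where u = "x \<otimes> y"]) auto
    then show "frac T A (v \<otimes> a \<oplus> s \<otimes> c) (s \<otimes> v) = frac T A (w \<otimes> b \<oplus> t \<otimes> d) (t \<otimes> w)"
      unfolding frac_def by (rule equiv_class_eq[OF equiv_frac_rel])
  qed
  from UN_equiv_class2[OF equiv_frac_rel equiv_frac_rel this, of "(r, s)" "(r', s')"] assms
  show ?thesis by (simp add: localization_def frac_def case_prod_unfold)
qed

end

end

theory Submission
  imports Defs "HOL-Algebra.QuotRing"
begin

text \<open>
  The scalar that witnesses maximality of the zero ideal of \<open>R\<close> also works, after mapping it to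
  the localization. An ideal \<open>J\<close> of the localization is controlled by its contraction, the
  preimage of \<open>J\<close> under \<open>r \<mapsto> r/1\<close>: every \<open>r/s\<close> in \<open>J\<close> has its numerator in the contraction,
  because \<open>r/1 = (s/1)(r/s)\<close>. Hence if \<open>t\<close> kills the contraction, then \<open>t/1\<close> kills \<open>J\<close>; and if
  the contraction meets \<open>S\<close>, then \<open>J\<close> meets the image of \<open>S\<close>.

  To speak of ideals at all, the localization has to be a commutative ring and \<open>r \<mapsto> r/1\<close> a ring
  homomorphism. Both reduce to computing with fractions through \<open>frac_mult\<close>, \<open>frac_add\<close> and the
  equality criterion \<open>frac_eq_iff\<close>.
\<close>

context mult_closed_subset
begin

abbreviation (input) L where "L \<equiv> localization T A"

lemma frac_eq_iff:
  assumes "r \<in> carrier A" "s \<in> T" "r' \<in> carrier A" "s' \<in> T"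
  shows "frac T A r s = frac T A r' s' \<longleftrightarrow> (\<exists>u\<in>T. u \<otimes> (s' \<otimes> r) = u \<otimes> (s \<otimes> r'))"
proof -
  have "frac T A r s = frac T A r' s' \<longleftrightarrow> ((r, s), (r', s')) \<in> frac_rel T A"
    unfolding frac_def using assms by (intro eq_equiv_class_iff[OF equiv_frac_rel]) auto
  also have "\<dots> \<longleftrightarrow> (\<exists>u\<in>T. u \<otimes> (s' \<otimes> r) = u \<otimes> (s \<otimes> r'))"
    using assms by (blast intro: frac_relI elim: frac_relE)
  finally show ?thesis .
qed

lemma frac_eqI:
  assumes "s' \<otimes> r = s \<otimes> r'"
    and "r \<in> carrier A" "s \<in> T" "r' \<in> carrier A" "s' \<in> T"
  shows "frac T A r s = frac T A r' s'"
  using assms by (auto simp: frac_eq_iff intro!: bexI[of _ \<one>])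

lemma frac_closed [simp]:
  assumes "r \<in> carrier A" "s \<in> T"
  shows "frac T A r s \<in> carrier L"
  using assms by (auto simp: localization_def frac_def intro: quotientI)

lemma frac_cases:
  assumes "x \<in> carrier L"
  obtains r s where "r \<in> carrier A" "s \<in> T" "x = frac T A r s"
  using assms by (auto simp: localization_def frac_def elim!: quotientE)

lemma zero_localization: "\<zero>\<^bsub>L\<^esub> = frac T A \<zero> \<one>"
  and one_localization: "\<one>\<^bsub>L\<^esub> = frac T A \<one> \<one>"
  by (simp_all add: localization_def)

lemma frac_eq_zero_iff:
  assumes "r \<in> carrier A" "s \<in> T"
  shows "frac T A r s = \<zero>\<^bsub>L\<^esub> \<longleftrightarrow> (\<exists>u\<in>T. u \<otimes> r = \<zero>)"
  using assms by (auto simp: zero_localization frac_eq_iff)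

lemma cring_localization: "cring L"
proof (rule cringI)
  show "abelian_group L"
  proof (rule abelian_groupI)
    fix x y z assume "x \<in> carrier L" "y \<in> carrier L" "z \<in> carrier L"
    then obtain a s b t c v where
      "a \<in> carrier A" "s \<in> T" "x = frac T A a s"
      "b \<in> carrier A" "t \<in> T" "y = frac T A b t"
      "c \<in> carrier A" "v \<in> T" "z = frac T A c v"
      by (metis frac_cases)
    then show "(x \<oplus>\<^bsub>L\<^esub> y) \<oplus>\<^bsub>L\<^esub> z = x \<oplus>\<^bsub>L\<^esub> (y \<oplus>\<^bsub>L\<^esub> z)"
      by (simp add: frac_add r_distr m_ac a_ac)
  next
    fix x y assume "x \<in> carrier L" "y \<in> carrier L"
    then obtain a s b t where
      "a \<in> carrier A" "s \<in> T" "x = frac T A a s" "b \<in> carrier A" "t \<in> T" "y = frac T A b t"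
      by (metis frac_cases)
    then show "x \<oplus>\<^bsub>L\<^esub> y = y \<oplus>\<^bsub>L\<^esub> x" "x \<oplus>\<^bsub>L\<^esub> y \<in> carrier L"
      by (simp_all add: frac_add m_comm a_comm)
  next
    fix x assume "x \<in> carrier L"
    then obtain a s where x: "a \<in> carrier A" "s \<in> T" "x = frac T A a s"
      by (rule frac_cases)
    then show "\<zero>\<^bsub>L\<^esub> \<oplus>\<^bsub>L\<^esub> x = x"
      by (simp add: zero_localization frac_add)
    have "frac T A (\<ominus> a) s \<oplus>\<^bsub>L\<^esub> x = \<zero>\<^bsub>L\<^esub>"
      using x by (auto simp: frac_add frac_eq_zero_iff r_minus l_neg intro!: bexI[of _ \<one>])
    with x show "\<exists>y\<in>carrier L. y \<oplus>\<^bsub>L\<^esub> x = \<zero>\<^bsub>L\<^esub>"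
      by (metis frac_closed a_inv_closed)
  qed (simp add: zero_localization)
next
  show "comm_monoid L"
  proof (rule comm_monoidI)
    fix x y z assume "x \<in> carrier L" "y \<in> carrier L" "z \<in> carrier L"
    then obtain a s b t c v where
      "a \<in> carrier A" "s \<in> T" "x = frac T A a s"
      "b \<in> carrier A" "t \<in> T" "y = frac T A b t"
      "c \<in> carrier A" "v \<in> T" "z = frac T A c v"
      by (metis frac_cases)
    then show "(x \<otimes>\<^bsub>L\<^esub> y) \<otimes>\<^bsub>L\<^esub> z = x \<otimes>\<^bsub>L\<^esub> (y \<otimes>\<^bsub>L\<^esub> z)"
      by (simp add: frac_mult m_assoc)
  next
    fix x y assume "x \<in> carrier L" "y \<in> carrier L"
    then obtain a s b t where
      "a \<in> carrier A" "s \<in> T" "x = frac T A a s" "b \<in> carrier A" "t \<in> T" "y = frac T A b t"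
      by (metis frac_cases)
    then show "x \<otimes>\<^bsub>L\<^esub> y = y \<otimes>\<^bsub>L\<^esub> x" "x \<otimes>\<^bsub>L\<^esub> y \<in> carrier L"
      by (simp_all add: frac_mult m_comm)
  next
    fix x assume "x \<in> carrier L"
    then show "\<one>\<^bsub>L\<^esub> \<otimes>\<^bsub>L\<^esub> x = x"
      by (auto simp: one_localization frac_mult elim!: frac_cases)
  qed (simp add: one_localization)
next
  fix x y z assume "x \<in> carrier L" "y \<in> carrier L" "z \<in> carrier L"
  then obtain a s b t c v where xyz:
    "a \<in> carrier A" "s \<in> T" "x = frac T A a s"
    "b \<in> carrier A" "t \<in> T" "y = frac T A b t"
    "c \<in> carrier A" "v \<in> T" "z = frac T A c v"
    by (metis frac_cases)
  \<comment> \<open>Expanding the right-hand side gives the denominator \<open>(s v)(t v)\<close> in place of \<open>(s t) v\<close>,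
    so the two fractions have to be compared by cross-multiplication.\<close>
  have "frac T A ((t \<otimes> a \<oplus> s \<otimes> b) \<otimes> c) ((s \<otimes> t) \<otimes> v) =
      frac T A ((t \<otimes> v) \<otimes> (a \<otimes> c) \<oplus> (s \<otimes> v) \<otimes> (b \<otimes> c)) ((s \<otimes> v) \<otimes> (t \<otimes> v))"
    by (rule frac_eqI) (use xyz in \<open>simp_all add: l_distr r_distr m_ac\<close>)
  with xyz show "(x \<oplus>\<^bsub>L\<^esub> y) \<otimes>\<^bsub>L\<^esub> z = x \<otimes>\<^bsub>L\<^esub> z \<oplus>\<^bsub>L\<^esub> y \<otimes>\<^bsub>L\<^esub> z"
    by (simp add: frac_add frac_mult)
qed

lemma localization_map_hom: "localization_map T A \<in> ring_hom A L"
  by (rule ring_hom_memI)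
    (simp_all add: localization_map_def frac_mult frac_add one_localization)

lemma localization_map_ring_hom: "ring_hom_ring A L (localization_map T A)"
  using cring_localization localization_map_hom
  by (simp add: ring_hom_ringI2 ring_axioms cring.axioms(1))

text \<open>
  The image of \<open>T\<close> avoids zero: if \<open>s/1 = 0\<close> then \<open>u s = 0\<close> for some \<open>u \<in> T\<close>, which is impossible
  because \<open>u s \<in> T\<close>. This is where \<open>\<zero> \<notin> T\<close> keeps the localization from collapsing.
\<close>

lemma mult_closed_subset_localization: "mult_closed_subset (localization_map T A ` T) L"
proof -
  interpret L: cring L by (rule cring_localization)
  show ?thesis
  proof (intro mult_closed_subset.intro mult_closed_subset_axioms.intro submonoid.intro)
    show "\<zero>\<^bsub>L\<^esub> \<notin> localization_map T A ` T"
    proof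
      assume "\<zero>\<^bsub>L\<^esub> \<in> localization_map T A ` T"
      then obtain s where s: "s \<in> T" "frac T A s \<one> = \<zero>\<^bsub>L\<^esub>"
        by (auto simp: localization_map_def)
      then obtain u where "u \<in> T" "u \<otimes> s = \<zero>"
        by (auto simp: frac_eq_zero_iff)
      with s zero_notin show False by (metis m_closed)
    qed
  qed (auto simp: localization_map_def frac_mult one_localization cring_localization)
qed

text \<open>Denominators can be cleared inside an ideal, since \<open>r/1 = (s/1)(r/s)\<close>.\<close>

lemma numerator_mem_ideal:
  assumes "ideal J L" and "frac T A r s \<in> J" and "r \<in> carrier A" "s \<in> T"
  shows "localization_map T A r \<in> J"
proof -
  have "frac T A r \<one> = frac T A (s \<otimes> r) s"
    by (rule frac_eqI) (use assms(3,4) in simp_all)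
  then have "localization_map T A r = frac T A s \<one> \<otimes>\<^bsub>L\<^esub> frac T A r s"
    using assms(3,4) by (simp add: localization_map_def frac_mult)
  also have "\<dots> \<in> J"
    using assms by (intro ideal.I_l_closed) auto
  finally show ?thesis .
qed

text \<open>
  An element that kills the numerators of the fractions in \<open>J\<close> kills the fractions themselves:
  \<open>(t/1)(r/s) = (t r)/s\<close>, and by clearing denominators \<open>r\<close> lies in the contraction of \<open>J\<close>.
\<close>

lemma annihilates_of_contraction:
  assumes "ideal J L" and t: "t \<in> T"
    and kills: "\<And>r. \<lbrakk>r \<in> carrier A; localization_map T A r \<in> J\<rbrakk> \<Longrightarrow> t \<otimes> r = \<zero>"
  shows "localization_map T A t <#\<^bsub>L\<^esub> J \<subseteq> {\<zero>\<^bsub>L\<^esub>}"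
proof -
  have "localization_map T A t \<otimes>\<^bsub>L\<^esub> x = \<zero>\<^bsub>L\<^esub>" if "x \<in> J" for x
  proof -
    from that \<open>ideal J L\<close> have "x \<in> carrier L"
      by (rule ideal.Icarr[rotated])
    then obtain r s where rs: "r \<in> carrier A" "s \<in> T" "x = frac T A r s"
      by (rule frac_cases)
    then have "t \<otimes> r = \<zero>"
      using numerator_mem_ideal[OF assms(1)] that kills by blast
    with rs t show ?thesis
      by (auto simp: localization_map_def frac_mult frac_eq_zero_iff intro!: bexI[of _ \<one>])
  qed
  then show ?thesis by (auto simp: l_coset_def)
qed

end

theorem proposition3p17:
  fixes R :: "('a, 'b) ring_scheme" (structure) and S :: "'a set"
  assumes "cring R"
    and "mult_closed_subset S R"
    and "T_field S R"
  shows "T_field (localization_map S R ` S) (localization S R)"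
proof -
  interpret mult_closed_subset S R by fact
  interpret max: T_maximal_ideal "{\<zero>}" S R
    using assms(3) by (rule T_field.zero_T_maximal)
  let ?L = "localization S R" and ?\<phi> = "localization_map S R"
  interpret L: mult_closed_subset "?\<phi> ` S" ?L
    by (rule mult_closed_subset_localization)
  obtain t where t: "t \<in> S"
    and t_max: "\<And>I. ideal I R \<Longrightarrow> {\<zero>} \<subseteq> I \<Longrightarrow> t <# I \<subseteq> {\<zero>} \<or> I \<inter> S \<noteq> {}"
    using max.T_maximal by blast
  have "?\<phi> t <#\<^bsub>?L\<^esub> J \<subseteq> {\<zero>\<^bsub>?L\<^esub>} \<or> J \<inter> ?\<phi> ` S \<noteq> {}" if J: "ideal J ?L" for J
  proof -
    let ?I = "{r \<in> carrier R. ?\<phi> r \<in> J}"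
    have I: "ideal ?I R"
      using localization_map_ring_hom J by (rule ring_hom_ring.ideal_vimage)
    have "{\<zero>} \<subseteq> ?I"
      using additive_subgroup.zero_closed[OF ideal.axioms(1)[OF I]] by simp
    from t_max[OF I this] show ?thesis
    proof
      assume "t <# ?I \<subseteq> {\<zero>}"
      then have "t \<otimes> r = \<zero>" if "r \<in> carrier R" "?\<phi> r \<in> J" for r
        using that by (auto simp: l_coset_def)
      then show ?thesis
        using annihilates_of_contraction[OF J t] by blast
    next
      assume "?I \<inter> S \<noteq> {}"
      then show ?thesis by blast
    qed
  qed
  then have "T_maximal_ideal {\<zero>\<^bsub>?L\<^esub>} (?\<phi> ` S) ?L"
    using t L.zero_notin
    by (intro T_maximal_ideal.intro T_maximal_ideal_axioms.intro
        L.mult_closed_subset_axioms L.zeroideal) auto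
  then show ?thesis
    by (intro T_field.intro T_field_axioms.intro L.mult_closed_subset_axioms)
qed

end
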